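(* (Local conservation of SUPG-GFQ.) Consider the homogeneous conservation law $\partial_t\mathbf W+\nabla\cdot\mathbf F(\mathbf W)=0$ discretized with the global-flux-quadrature SUPG method on continuous $\mathbb Q^K$ Gauss--Lobatto elements on a Cartesian mesh, and let $$\Phi_\alpha^{ij}=\int_{E_{ij}}\Big(\varphi_\alpha\,(\partial_{x^1}\partial_{x^2}\mathcal F_{1,h}+\partial_{x^2}\partial_{x^1}\mathcal F_{2,h})+\nabla\varphi_\alpha\cdot\mathbf J\,\tau\,\frac{d\mathbf W_h}{dt}+\nabla\varphi_\alpha\cdot\mathbf J\,\tau\,(\partial_{x^1}\partial_{x^2}\mathcal F_{1,h}+\partial_{x^2}\partial_{x^1}\mathcal F_{2,h})\Big)d\mathbf x$$ be its element fluctuations. Then for every element $E_{ij}$ $$\sum_{\alpha\in E_{ij}}\Phi_\alpha^{ij}=\oint_{\partial E_{ij}}\mathbf F_h\cdot\hat n\,dS,$$ where the sum runs over all nodes $\mathbf x_\alpha\in E_{ij}$, $\hat n$ is the outward unit normal, and $\mathbf F_h=(\mathbf F_{1,h},\mathbf F_{2,h})$ is the continuous nodal interpolant of the flux.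
   Context: Mesh and space. $\Omega=[x^1_0,x^1_0+L_1]\times[x^2_0,x^2_0+L_2]$ is divided into $N_1\times N_2$ elements $E_{ij}=[x^1_i,x^1_{i+1}]\times[x^2_j,x^2_{j+1}]$ with uniform sizes $h_m=L_m/N_m$. Fix $K\ge1$. In every one-dimensional cell take the $K+1$ Gauss--Lobatto points $x^m_{\ell,0}=x^m_\ell<\dots<x^m_{\ell,K}=x^m_{\ell+1}$. $V_h^K$ is the space of continuous functions on $\Omega$ whose restriction to each element is in $\mathbb Q^K$ (degree at most $K$ in each variable). Its nodes $\mathbf x_\alpha$ are the tensor products of the one-dimensional points, and $\varphi_\alpha$ is the nodal basis, $\varphi_\alpha(\mathbf x_\beta)=\delta_{\alpha\beta}$. Discrete fluxes and potentials. $\mathbf W_h\in(V_h^K)^s$ has nodal values $\mathbf W_\alpha$, and $\mathbf F_{m,h}\in (V_h^K)^s$ is the nodal interpolant of $\mathbf F_m(\mathbf W_\alpha)$, $m=1,2$. The potentials $\mathcal F_{1,h},\mathcal F_{2,h}\in(V_h^K)^s$ are the functions with values at every node $(a,b)$ $$\mathcal F_{1,h}(a,b)=\int_{x^2_0}^{b}\mathbf F_{1,h}(a,\eta)\,d\eta,\qquad \mathcal F_{2,h}(a,b)=\int_{x^1_0}^{a}\mathbf F_{2,h}(\xi,b)\,d\xi .$$ $\mathbf J=(\mathbf J_1,\mathbf J_2)$ with $\mathbf J_m=\partial\mathbf F_m/\partial\mathbf W$ are the flux Jacobians, $\tau$ is an $s\times s$ matrix stabilization parameter depending on $\mathbf W$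 and the mesh, and $\nabla\varphi\cdot\mathbf J\,\tau=\partial_{x^1}\varphi\,\mathbf J_1\tau+\partial_{x^2}\varphi\,\mathbf J_2\tau$. Derivatives are taken element-wise. The integrals in $\Phi^{ij}_\alpha$ are evaluated with the tensor-product Gauss--Lobatto quadrature based on the interpolation nodes of the element (exact for degree up to $2K-1$ in each variable). *)

theory Defs
  imports "HOL-Analysis.Analysis" "HOL-Computational_Algebra.Polynomial"
begin

section \<open>Gauss--Lobatto nodes and weights on the reference interval\<close>

text \<open>Rodrigues' formula.\<close>

definition legendre :: "nat \<Rightarrow> real poly" where
  "legendre n = smult (1 / (2 ^ n * fact n)) ((pderiv ^^ n) ([:-1, 0, 1:] ^ n))"

text \<open>The \<open>K + 1\<close> Gauss--Lobatto points are the zeros of \<open>(1 - x\<^sup>2) P\<^sub>K'(x)\<close>,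
  in increasing order. This is meant for \<open>K \<ge> 1\<close> and \<open>k \<le> K\<close> only.\<close>

definition gl_point :: "nat \<Rightarrow> nat \<Rightarrow> real" where
  "gl_point K k =
     sorted_list_of_set {x. poly ([:1, 0, -1:] * pderiv (legendre K)) x = 0} ! k"

definition gl_lagrange :: "nat \<Rightarrow> nat \<Rightarrow> real \<Rightarrow> real" where
  "gl_lagrange K k x =
     (\<Prod>l\<in>{..K} - {k}. (x - gl_point K l) / (gl_point K k - gl_point K l))"

definition gl_weight :: "nat \<Rightarrow> nat \<Rightarrow> real" where
  "gl_weight K k = integral {-1..1} (gl_lagrange K k)"


section \<open>Uniform Cartesian meshes\<close>

record mesh1d =
  mesh_origin :: real
  mesh_length :: real
  mesh_cells :: nat

definition valid_mesh :: "mesh1d \<Rightarrow> bool" where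
  "valid_mesh M \<longleftrightarrow> mesh_length M > 0 \<and> mesh_cells M \<ge> 1"

definition mesh_size :: "mesh1d \<Rightarrow> real" where
  "mesh_size M = mesh_length M / real (mesh_cells M)"

definition grid_point :: "mesh1d \<Rightarrow> nat \<Rightarrow> real" where
  "grid_point M l = mesh_origin M + real l * mesh_size M"

definition cell :: "mesh1d \<Rightarrow> nat \<Rightarrow> real set" where
  "cell M l = {grid_point M l .. grid_point M (Suc l)}"

definition cell_point :: "mesh1d \<Rightarrow> nat \<Rightarrow> nat \<Rightarrow> nat \<Rightarrow> real" where
  "cell_point M K l k = grid_point M l + mesh_size M * (1 + gl_point K k) / 2"

definition nodes1d :: "mesh1d \<Rightarrow> nat \<Rightarrow> real set" where
  "nodes1d M K = {cell_point M K l k | l k. l < mesh_cells M \<and> k \<le> K}"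

text \<open>A two-dimensional mesh is the pair of its two factors.\<close>

type_synonym mesh2d = "mesh1d \<times> mesh1d"

definition domain :: "mesh2d \<Rightarrow> (real \<times> real) set" where
  "domain M =
     {mesh_origin (fst M) .. mesh_origin (fst M) + mesh_length (fst M)} \<times>
     {mesh_origin (snd M) .. mesh_origin (snd M) + mesh_length (snd M)}"

definition elements :: "mesh2d \<Rightarrow> (nat \<times> nat) set" where
  "elements M = {..<mesh_cells (fst M)} \<times> {..<mesh_cells (snd M)}"

definition element :: "mesh2d \<Rightarrow> nat \<times> nat \<Rightarrow> (real \<times> real) set" where
  "element M e = cell (fst M) (fst e) \<times> cell (snd M) (snd e)"

text \<open>A multi-index is identified with its node, so that the same
  point seen from neighbouring elements is a single degree of freedom.\<close>

definition nodes :: "mesh2d \<Rightarrow> nat \<Rightarrow> (real \<times> real) set" where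
  "nodes M K = nodes1d (fst M) K \<times> nodes1d (snd M) K"


section \<open>The finite element space\<close>

text \<open>Functions are total on the plane; values outside \<open>domain M\<close> are irrelevant.\<close>

definition fe_space :: "mesh2d \<Rightarrow> nat \<Rightarrow> (real \<times> real \<Rightarrow> real) set" where
  "fe_space M K = {u. continuous_on (domain M) u \<and>
     (\<forall>e\<in>elements M. \<exists>c :: nat \<Rightarrow> nat \<Rightarrow> real. \<forall>(x, y)\<in>element M e.
        u (x, y) = (\<Sum>p\<le>K. \<Sum>q\<le>K. c p q * x ^ p * y ^ q))}"

definition fe_space_vec :: "mesh2d \<Rightarrow> nat \<Rightarrow> (real \<times> real \<Rightarrow> real ^ 's) set" where
  "fe_space_vec M K = {u. \<forall>c. (\<lambda>x. u x $ c) \<in> fe_space M K}"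

definition nodal_basis ::
  "mesh2d \<Rightarrow> nat \<Rightarrow> (real \<times> real \<Rightarrow> real \<times> real \<Rightarrow> real) \<Rightarrow> bool" where
  "nodal_basis M K \<phi> \<longleftrightarrow> (\<forall>\<alpha>\<in>nodes M K. \<phi> \<alpha> \<in> fe_space M K \<and>
     (\<forall>\<beta>\<in>nodes M K. \<phi> \<alpha> \<beta> = (if \<alpha> = \<beta> then 1 else 0)))"

definition nodal_interpolant ::
  "mesh2d \<Rightarrow> nat \<Rightarrow> (real \<times> real \<Rightarrow> real ^ 's) \<Rightarrow> (real \<times> real \<Rightarrow> real ^ 's) \<Rightarrow> bool" where
  "nodal_interpolant M K v u \<longleftrightarrow> u \<in> fe_space_vec M K \<and> (\<forall>\<alpha>\<in>nodes M K. u \<alpha> = v \<alpha>)"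

definition flux_potential1 ::
  "mesh2d \<Rightarrow> nat \<Rightarrow> (real \<times> real \<Rightarrow> real ^ 's) \<Rightarrow> (real \<times> real \<Rightarrow> real ^ 's) \<Rightarrow> bool" where
  "flux_potential1 M K f P \<longleftrightarrow>
     nodal_interpolant M K (\<lambda>(a, b). integral {mesh_origin (snd M)..b} (\<lambda>\<eta>. f (a, \<eta>))) P"

definition flux_potential2 ::
  "mesh2d \<Rightarrow> nat \<Rightarrow> (real \<times> real \<Rightarrow> real ^ 's) \<Rightarrow> (real \<times> real \<Rightarrow> real ^ 's) \<Rightarrow> bool" where
  "flux_potential2 M K f P \<longleftrightarrow>
     nodal_interpolant M K (\<lambda>(a, b). integral {mesh_origin (fst M)..a} (\<lambda>\<xi>. f (\<xi>, b))) P"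


section \<open>Element-wise operations\<close>

text \<open>On the boundary of the element these are the one-sided derivatives from its inside.\<close>

definition elem_dx1 ::
  "mesh2d \<Rightarrow> nat \<times> nat \<Rightarrow> (real \<times> real \<Rightarrow> 'a::real_normed_vector) \<Rightarrow> real \<times> real \<Rightarrow> 'a" where
  "elem_dx1 M e u = (\<lambda>(a, b).
     vector_derivative (\<lambda>\<xi>. u (\<xi>, b)) (at a within cell (fst M) (fst e)))"

definition elem_dx2 ::
  "mesh2d \<Rightarrow> nat \<times> nat \<Rightarrow> (real \<times> real \<Rightarrow> 'a::real_normed_vector) \<Rightarrow> real \<times> real \<Rightarrow> 'a" where
  "elem_dx2 M e u = (\<lambda>(a, b).
     vector_derivative (\<lambda>\<eta>. u (a, \<eta>)) (at b within cell (snd M) (snd e)))"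

definition gl_quadrature ::
  "mesh2d \<Rightarrow> nat \<Rightarrow> nat \<times> nat \<Rightarrow> (real \<times> real \<Rightarrow> 'a::real_vector) \<Rightarrow> 'a" where
  "gl_quadrature M K e f =
     (\<Sum>k\<le>K. \<Sum>l\<le>K.
        (mesh_size (fst M) / 2 * gl_weight K k * (mesh_size (snd M) / 2 * gl_weight K l)) *\<^sub>R
        f (cell_point (fst M) K (fst e) k, cell_point (snd M) K (snd e) l))"

text \<open>The flux divergence is the mixed-derivative expression in the potentials \<open>P1\<close>, \<open>P2\<close>.\<close>

definition gf_divergence ::
  "mesh2d \<Rightarrow> nat \<times> nat \<Rightarrow> (real \<times> real \<Rightarrow> real ^ 's) \<Rightarrow> (real \<times> real \<Rightarrow> real ^ 's) \<Rightarrow>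
   real \<times> real \<Rightarrow> real ^ 's" where
  "gf_divergence M e P1 P2 x =
     elem_dx1 M e (elem_dx2 M e P1) x + elem_dx2 M e (elem_dx1 M e P2) x"

definition supg_matrix ::
  "mesh2d \<Rightarrow> nat \<times> nat \<Rightarrow> (real \<times> real \<Rightarrow> real) \<Rightarrow>
   (real \<times> real \<Rightarrow> real ^ 's ^ 's) \<Rightarrow> (real \<times> real \<Rightarrow> real ^ 's ^ 's) \<Rightarrow>
   (real \<times> real \<Rightarrow> real ^ 's ^ 's) \<Rightarrow> real \<times> real \<Rightarrow> real ^ 's ^ 's" where
  "supg_matrix M e \<psi> J1 J2 \<tau> x =
     elem_dx1 M e \<psi> x *\<^sub>R (J1 x ** \<tau> x) + elem_dx2 M e \<psi> x *\<^sub>R (J2 x ** \<tau> x)"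

text \<open>Here \<open>\<psi>\<close> is the test function and \<open>D\<close> the time derivative of the discrete solution.\<close>

definition fluctuation ::
  "mesh2d \<Rightarrow> nat \<Rightarrow> nat \<times> nat \<Rightarrow> (real \<times> real \<Rightarrow> real) \<Rightarrow>
   (real \<times> real \<Rightarrow> real ^ 's) \<Rightarrow> (real \<times> real \<Rightarrow> real ^ 's) \<Rightarrow>
   (real \<times> real \<Rightarrow> real ^ 's ^ 's) \<Rightarrow> (real \<times> real \<Rightarrow> real ^ 's ^ 's) \<Rightarrow>
   (real \<times> real \<Rightarrow> real ^ 's ^ 's) \<Rightarrow> (real \<times> real \<Rightarrow> real ^ 's) \<Rightarrow> real ^ 's" where
  "fluctuation M K e \<psi> P1 P2 J1 J2 \<tau> D =
     gl_quadrature M K e (\<lambda>x.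
       \<psi> x *\<^sub>R gf_divergence M e P1 P2 x
       + supg_matrix M e \<psi> J1 J2 \<tau> x *v D x
       + supg_matrix M e \<psi> J1 J2 \<tau> x *v gf_divergence M e P1 P2 x)"


section \<open>Flux through the boundary of an element\<close>

text \<open>The arc-length integral of \<open>f1 n\<^sub>1 + f2 n\<^sub>2\<close> over the segment from \<open>p\<close> to \<open>q\<close>.\<close>

definition edge_flux ::
  "real \<times> real \<Rightarrow> real \<times> real \<Rightarrow> real \<times> real \<Rightarrow>
   (real \<times> real \<Rightarrow> real ^ 's) \<Rightarrow> (real \<times> real \<Rightarrow> real ^ 's) \<Rightarrow> real ^ 's" where
  "edge_flux p q n f1 f2 =
     integral {0..1} (\<lambda>r. dist p q *\<^sub>R
       (fst n *\<^sub>R f1 (linepath p q r) + snd n *\<^sub>R f2 (linepath p q r)))"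

definition boundary_flux ::
  "mesh2d \<Rightarrow> nat \<times> nat \<Rightarrow>
   (real \<times> real \<Rightarrow> real ^ 's) \<Rightarrow> (real \<times> real \<Rightarrow> real ^ 's) \<Rightarrow> real ^ 's" where
  "boundary_flux M e f1 f2 =
     (let a = grid_point (fst M) (fst e); b = grid_point (fst M) (Suc (fst e));
          c = grid_point (snd M) (snd e); d = grid_point (snd M) (Suc (snd e))
      in edge_flux (a, c) (b, c) (0, -1) f1 f2 + edge_flux (b, c) (b, d) (1, 0) f1 f2
       + edge_flux (b, d) (a, d) (0, 1) f1 f2 + edge_flux (a, d) (a, c) (-1, 0) f1 f2)"

end

(* The basis functions attached to the nodes of an element sum to 1 on it, by unisolvence of Q^K on
   the tensor grid. Hence the sum of their gradients vanishes there and every stabilization term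
   cancels; what remains is the quadrature of the mixed derivatives of the potentials. These have
   degree at most K - 1 in each variable, so the quadrature is exact and telescopes to the corner
   values of the potentials. Corners are nodes, where the potentials are the integrals of the
   interpolated fluxes, and the differences of corner values are the edge integrals. *)

theory Submission
  imports Defs
begin

text \<open>Two features of the definitions shape the argument. \<open>gl_point\<close> reads
  entries of a sorted list of zeros, so it is informative only once \<open>(1 - x^2) P_K'\<close> is
  known to have exactly \<open>K + 1\<close> distinct real zeros, the extreme ones being -1 and 1.
  This comes from repeated use of Rolle's theorem, starting from \<open>(x^2 - 1)^K\<close>, whose
  zeros -1 and 1 have multiplicity \<open>K\<close>. Distinctness then yields the Lagrange basis and
  unisolvence, and the extreme zeros are what turn the corners of an element into nodes. The weights
  are integrals of Lagrange polynomials, so exactness is a matter of interpolation. Gauss--Lobatto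
  points lie on element boundaries too, where the derivatives taken from two neighbouring elements
  may differ. Derivatives are therefore taken within the closed cell, and every discrete function is
  replaced on one element by a finite sum of separated monomials. The stabilization terms cancel
  pointwise, at each quadrature point separately.\<close>

section \<open>Gauss--Lobatto points and weights\<close>

text \<open>Induction that adds the zeros in increasing order: each new largest zero
  \<open>b\<close> contributes one zero of the derivative, strictly between the previous maximum and
  \<open>b\<close>. The enclosing open interval is part of the claim because it separates this new
  zero from the earlier ones.\<close>

lemma poly_rolle_finite:
  fixes p :: "real poly"
  assumes "finite B" "\<And>x. x \<in> B \<Longrightarrow> poly p x = 0" "B \<noteq> {}"
  shows "\<exists>C. finite C \<and> card C = card B - 1 \<and> C \<subseteq> {Min B<..<Max B} \<and>
    (\<forall>x\<in>C. poly (pderiv p) x = 0)"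
  using assms
proof (induction B rule: finite_linorder_max_induct)
  case empty
  then show ?case by simp
next
  case (insert b A)
  show ?case
  proof (cases "A = {}")
    case True
    then show ?thesis by (intro exI[of _ "{}"]) simp
  next
    case False
    then obtain C where C: "finite C" "card C = card A - 1" "C \<subseteq> {Min A<..<Max A}"
        "\<forall>x\<in>C. poly (pderiv p) x = 0"
      using insert by auto
    have MaxA: "Max A \<in> A" "Max A < b"
      using insert.hyps False by auto
    have Max_insert: "Max (insert b A) = b"
      by (rule Max_eqI) (use insert.hyps in \<open>auto intro: less_imp_le\<close>)
    have "Min A \<in> A"
      using insert.hyps(1) False by simp
    then have Min_insert: "Min (insert b A) = Min A"
      by (intro Min_eqI) (use insert.hyps in \<open>auto intro: less_imp_le\<close>)
    \<comment> \<open>\<open>p\<close> vanishes at both ends, so the left side of the mean value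
      identity is 0 while the factor \<open>b - Max A\<close> is not.\<close>
    obtain z where z: "Max A < z" "z < b" "poly p b - poly p (Max A) = (b - Max A) * poly (pderiv p) z"
      using poly_MVT[OF MaxA(2)] by blast
    have "poly (pderiv p) z = 0"
      using z insert.prems MaxA by auto
    moreover have "z \<notin> C"
      using C(3) z by auto
    moreover have "card A > 0"
      using False insert.hyps by (simp add: card_gt_0_iff)
    moreover have "b \<notin> A"
      using insert.hyps by auto
    moreover have "Min A \<le> Max A"
      using Min_le[OF insert.hyps(1) MaxA(1)] .
    moreover have "z \<in> {Min A<..<b}" "C \<subseteq> {Min A<..<b}"
      using C(3) z MaxA(2) \<open>Min A \<le> Max A\<close> by auto
    ultimately have "finite (insert z C) \<and> card (insert z C) = card (insert b A) - 1 \<and>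
        insert z C \<subseteq> {Min A<..<b} \<and> (\<forall>x\<in>insert z C. poly (pderiv p) x = 0)"
      using C(1,2,4) insert.hyps(1) by simp
    then show ?thesis
      unfolding Max_insert Min_insert by (rule exI)
  qed
qed

lemma power_dvd_pderiv:
  fixes p q :: "'a::idom poly"
  assumes "q ^ Suc m dvd p"
  shows "q ^ m dvd pderiv p"
proof -
  obtain r where "p = q ^ Suc m * r"
    using assms by (auto elim: dvdE)
  then have "pderiv p = q ^ m * (q * pderiv r + r * smult (of_nat (Suc m)) (pderiv q))"
    by (simp add: pderiv_mult pderiv_power_Suc algebra_simps del: power_Suc)
       (simp add: algebra_simps)
  then show ?thesis by simp
qed

text \<open>Each derivative costs at most one power of \<open>q\<close>. With linear
  \<open>q\<close> this keeps -1 and 1 among the zeros of the derivatives of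
  \<open>(x^2 - 1)^n\<close> of order below \<open>n\<close>.\<close>

lemma power_dvd_pderiv_iterate:
  fixes p q :: "'a::idom poly"
  assumes "q ^ n dvd p" "j \<le> n"
  shows "q ^ (n - j) dvd (pderiv ^^ j) p"
  using assms(2)
proof (induction j)
  case 0
  then show ?case using assms(1) by simp
next
  case (Suc j)
  then have "q ^ Suc (n - Suc j) dvd (pderiv ^^ j) p"
    by (simp add: Suc_diff_Suc del: power_Suc)
  from power_dvd_pderiv[OF this] show ?case by simp
qed

lemma degree_pderiv_iterate:
  fixes p :: "real poly"
  shows "degree ((pderiv ^^ j) p) = degree p - j"
  by (induction j) (auto simp: degree_pderiv)

text \<open>The classical argument for the zeros of Legendre polynomials. While
  \<open>j < n\<close>, the \<open>j\<close> inner zeros together with -1 and 1 are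
  \<open>j + 2\<close> zeros, and Rolle's theorem gives \<open>j + 1\<close> inner zeros of the next
  derivative.\<close>

lemma pderiv_iterate_roots:
  assumes "j \<le> n"
  shows "\<exists>B. finite B \<and> card B = j \<and> B \<subseteq> {-1<..<1} \<and>
    (\<forall>x\<in>B. poly ((pderiv ^^ j) ([:-1, 0, 1 :: real:] ^ n)) x = 0)"
  using assms
proof (induction j)
  case 0
  then show ?case by (intro exI[of _ "{}"]) simp
next
  case (Suc j)
  define p where "p = [:-1, 0, 1 :: real:] ^ n"
  obtain B where B: "finite B" "card B = j" "B \<subseteq> {-1<..<1}"
      "\<forall>x\<in>B. poly ((pderiv ^^ j) p) x = 0"
    using Suc by (auto simp: p_def)
  have factor: "[:-1, 0, 1:] = [:-1, 1:] * [:1, 1 :: real:]" by simp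
  \<comment> \<open>\<open>Suc j \<le> n\<close> leaves the linear factor with the positive exponent
    \<open>n - j\<close>, hence a genuine zero.\<close>
  have root: "poly ((pderiv ^^ j) p) x = 0" if "[:-x, 1:] ^ n dvd p" for x
  proof -
    have "[:-x, 1:] dvd [:-x, 1:] ^ (n - j)"
      using Suc.prems by (intro dvd_power) auto
    also have "\<dots> dvd (pderiv ^^ j) p"
      using that Suc.prems by (intro power_dvd_pderiv_iterate) auto
    finally show ?thesis by (simp add: poly_eq_0_iff_dvd)
  qed
  have "[:-1, 1:] ^ n dvd p" "[:-(-1), 1:] ^ n dvd p"
    unfolding p_def factor power_mult_distrib minus_minus by (rule dvd_triv_left dvd_triv_right)+
  then have ends: "poly ((pderiv ^^ j) p) 1 = 0" "poly ((pderiv ^^ j) p) (-1) = 0"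
    by (blast intro: root)+
  have B_bounds: "\<forall>x\<in>B. -1 < x \<and> x < 1"
    using B(3) by auto
  have Max: "Max (insert (-1) (insert 1 B)) = 1"
    by (rule Max_eqI) (use B(1) B_bounds in \<open>auto intro: less_imp_le\<close>)
  have Min: "Min (insert (-1) (insert 1 B)) = -1"
    by (rule Min_eqI) (use B(1) B_bounds in \<open>auto intro: less_imp_le\<close>)
  have card: "card (insert (-1) (insert 1 B)) = j + 2"
    using B(1,2) B_bounds by (auto simp: card_insert_if)
  have "\<exists>C. finite C \<and> card C = j + 2 - 1 \<and> C \<subseteq> {-1<..<1} \<and>
      (\<forall>x\<in>C. poly (pderiv ((pderiv ^^ j) p)) x = 0)"
    by (rule poly_rolle_finite[of "insert (-1) (insert 1 B)" "(pderiv ^^ j) p", unfolded Max Min card])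
       (use B(1,4) ends in auto)
  then show ?case
    by (simp add: p_def)
qed

text \<open>The Legendre polynomial has \<open>K\<close> zeros in the open interval, so Rolle's
  theorem gives \<open>K - 1\<close> zeros of its derivative there. The degree allows no others, and
  the factor \<open>1 - x^2\<close> adds the two end points.\<close>

lemma gl_roots:
  assumes "K \<ge> 1"
  defines "S \<equiv> {x. poly ([:1, 0, -1:] * pderiv (legendre K)) x = 0}"
  shows "finite S" "card S = K + 1" "-1 \<in> S" "1 \<in> S" "S \<subseteq> {-1..1}"
proof -
  define P where "P = (pderiv ^^ K) ([:-1, 0, 1 :: real:] ^ K)"
  have legendre: "legendre K = smult (1 / (2 ^ K * fact K)) P"
    by (simp add: legendre_def P_def)
  have "degree P = K"
    by (simp add: P_def degree_pderiv_iterate degree_power_eq)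
  then have nz: "pderiv P \<noteq> 0" and deg: "degree (pderiv P) = K - 1"
    using assms(1) by (auto simp: pderiv_eq_0_iff degree_pderiv)
  have S: "S = insert (-1) (insert 1 {x. poly (pderiv P) x = 0})"
    by (auto simp: S_def legendre pderiv_smult square_eq_1_iff algebra_simps power2_eq_square)
  obtain B where B: "finite B" "card B = K" "B \<subseteq> {-1<..<1}" "\<forall>x\<in>B. poly P x = 0"
    using pderiv_iterate_roots[of K K] by (auto simp: P_def)
  have "B \<noteq> {}"
    using B assms(1) by auto
  then obtain C where C: "finite C" "card C = K - 1" "C \<subseteq> {Min B<..<Max B}"
      "\<forall>x\<in>C. poly (pderiv P) x = 0"
    using poly_rolle_finite[of B P] B by auto
  have "Min B \<in> B" "Max B \<in> B"
    using B \<open>B \<noteq> {}\<close> by auto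
  then have C_sub: "C \<subseteq> {-1<..<1}"
    using B(3) C(3) by fastforce
  \<comment> \<open>By counting: \<open>C\<close> already has as many elements as
    \<open>pderiv P\<close> can have zeros.\<close>
  have "C = {x. poly (pderiv P) x = 0}"
    using C card_poly_roots_bound[OF nz] poly_roots_finite[OF nz] deg
    by (intro card_seteq) auto
  then have S': "S = insert (-1) (insert 1 C)"
    by (simp add: S)
  show "finite S" "-1 \<in> S" "1 \<in> S" "S \<subseteq> {-1..1}"
    using S' C(1) C_sub by auto
  have "-1 \<notin> insert 1 C" "1 \<notin> C"
    using C_sub by auto
  then have "card S = card C + 2"
    unfolding S' using C(1) by simp
  then show "card S = K + 1"
    using C(2) assms(1) by simp
qed

lemma gl_point_strict_mono:
  assumes "K \<ge> 1" "k < l" "l \<le> K"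
  shows "gl_point K k < gl_point K l"
proof -
  let ?S = "{x. poly ([:1, 0, -1:] * pderiv (legendre K)) x = 0}"
  have "length (sorted_list_of_set ?S) = K + 1"
    using gl_roots(2)[OF assms(1)] unfolding length_sorted_list_of_set .
  then show ?thesis
    unfolding gl_point_def
    by (intro sorted_wrt_nth_less[OF strict_sorted_list_of_set assms(2)]) (use assms(3) in linarith)
qed

lemma gl_point_image:
  assumes "K \<ge> 1"
  shows "gl_point K ` {..K} = {x. poly ([:1, 0, -1:] * pderiv (legendre K)) x = 0}"
proof -
  let ?S = "{x. poly ([:1, 0, -1:] * pderiv (legendre K)) x = 0}"
  have len: "length (sorted_list_of_set ?S) = Suc K"
    using gl_roots(2)[OF assms] unfolding length_sorted_list_of_set by linarith
  have "gl_point K ` {..K} = (!) (sorted_list_of_set ?S) ` {0..<Suc K}"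
    unfolding gl_point_def atLeast0LessThan lessThan_Suc_atMost ..
  also have "\<dots> = set (sorted_list_of_set ?S)"
    using nth_image[of "Suc K" "sorted_list_of_set ?S"] unfolding len take_all[OF eq_imp_le[OF len]] by simp
  also have "\<dots> = ?S"
    by (rule set_sorted_list_of_set[OF gl_roots(1)[OF assms]])
  finally show ?thesis .
qed

lemma inj_on_gl_point: "K \<ge> 1 \<Longrightarrow> inj_on (gl_point K) {..K}"
  by (metis (no_types, lifting) atMost_iff gl_point_strict_mono inj_onI less_irrefl linorder_neqE_nat)

lemma gl_point_bounds:
  assumes "K \<ge> 1" "k \<le> K"
  shows "gl_point K k \<in> {-1..1}"
  using gl_roots(5)[OF assms(1)] gl_point_image[OF assms(1)] assms(2) by blast

text \<open>The value -1 is attained by some index and bounds all points from below, so strict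
  monotonicity forces the index to be 0. Together with its mirror image at index \<open>K\<close>
  this makes the grid points nodes.\<close>

lemma gl_point_first:
  assumes "K \<ge> 1"
  shows "gl_point K 0 = -1"
proof -
  obtain k where "k \<le> K" "gl_point K k = -1"
    using gl_roots(3)[OF assms] gl_point_image[OF assms] by (metis (no_types, lifting) atMost_iff imageE)
  then show ?thesis
    using gl_point_strict_mono[OF assms, of 0 k] gl_point_bounds[OF assms, of 0] by (cases "k = 0") auto
qed

lemma gl_point_last:
  assumes "K \<ge> 1"
  shows "gl_point K K = 1"
proof -
  obtain k where "k \<le> K" "gl_point K k = 1"
    using gl_roots(4)[OF assms] gl_point_image[OF assms] by (metis (no_types, lifting) atMost_iff imageE)
  then show ?thesis
    using gl_point_strict_mono[OF assms, of k K] gl_point_bounds[OF assms, of K] by (cases "k = K") auto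
qed

section \<open>Exactness of the interpolatory quadrature on the reference interval\<close>

lemma integrable_gl_lagrange: "gl_lagrange K k integrable_on {-1..1}"
  unfolding gl_lagrange_def divide_inverse
  by (intro integrable_continuous_interval continuous_intros)

text \<open>Degree \<open>K\<close> instead of \<open>2 * K - 1\<close> suffices, since the quadrature is only applied
  to the divergence of the potentials once the stabilization terms have cancelled.\<close>

lemma gl_weight_exact:
  assumes "K \<ge> 1" "degree p \<le> K"
  shows "(\<Sum>k\<le>K. gl_weight K k * poly p (gl_point K k)) = integral {-1..1} (poly p)"
proof -
  define L where "L k = (\<Prod>l\<in>{..K} - {k}. smult (1 / (gl_point K k - gl_point K l)) [:- gl_point K l, 1:])" for k
  have L: "poly (L k) x = gl_lagrange K k x" for k x
    by (simp add: L_def gl_lagrange_def poly_prod algebra_simps diff_divide_distrib)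
  have deg: "degree (L k) \<le> K" if "k \<le> K" for k
  proof -
    have "degree (L k) \<le> (\<Sum>l\<in>{..K} - {k}. degree (smult (1 / (gl_point K k - gl_point K l)) [:- gl_point K l, 1:]))"
      unfolding L_def by (rule order.trans[OF degree_prod_sum_le]) (simp_all only: o_def finite_Diff finite_atMost order.refl)
    also have "\<dots> \<le> (\<Sum>l\<in>{..K} - {k}. 1)"
      by (intro sum_mono) (simp add: degree_smult_eq)
    finally show ?thesis using that by simp
  qed
  have delta: "gl_lagrange K k (gl_point K j) = (if k = j then 1 else 0)" if "k \<le> K" "j \<le> K" for k j
    using that by (auto simp: gl_lagrange_def inj_on_eq_iff[OF inj_on_gl_point[OF assms(1)]]
        intro!: prod.neutral)
  \<comment> \<open>Lagrange interpolation as an identity of polynomials: both sides have degree at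
    most \<open>K\<close> and agree at \<open>K + 1\<close> distinct points.\<close>
  have eq: "p = (\<Sum>k\<le>K. smult (poly p (gl_point K k)) (L k))"
  proof (rule poly_eqI_degree[where A = "gl_point K ` {..K}"])
    show "poly p x = poly (\<Sum>k\<le>K. smult (poly p (gl_point K k)) (L k)) x"
      if "x \<in> gl_point K ` {..K}" for x
      using that by (auto simp: poly_sum L delta if_distrib cong: if_cong)
    have "degree (\<Sum>k\<le>K. smult (poly p (gl_point K k)) (L k)) \<le> K"
      using deg by (intro degree_sum_le) (auto intro: order.trans[OF degree_smult_le])
    moreover have card: "card (gl_point K ` {..K}) = K + 1"
      using card_image[OF inj_on_gl_point[OF assms(1)]] by simp
    ultimately show "degree (\<Sum>k\<le>K. smult (poly p (gl_point K k)) (L k)) < card (gl_point K ` {..K})"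
      by simp
    show "degree p < card (gl_point K ` {..K})"
      using assms(2) card by simp
  qed
  have "poly p x = (\<Sum>k\<le>K. poly p (gl_point K k) * gl_lagrange K k x)" for x
    by (rule trans[OF arg_cong[OF eq, of "\<lambda>q. poly q x"]]) (simp add: poly_sum L)
  then have "integral {-1..1} (poly p) =
      integral {-1..1} (\<lambda>x. \<Sum>k\<le>K. poly p (gl_point K k) * gl_lagrange K k x)"
    by (intro integral_cong)
  also have "\<dots> = (\<Sum>k\<le>K. poly p (gl_point K k) * gl_weight K k)"
    by (subst integral_sum)
       (auto simp: gl_weight_def integrable_on_mult_right integrable_gl_lagrange)
  finally show ?thesis by (simp add: mult.commute)
qed

section \<open>Mesh, tensor representation and quadrature\<close>

lemma mesh_size_pos: "valid_mesh M \<Longrightarrow> mesh_size M > 0"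
  by (simp add: valid_mesh_def mesh_size_def)

lemma grid_point_Suc: "grid_point M (Suc l) = grid_point M l + mesh_size M"
  by (simp add: grid_point_def algebra_simps)

lemma grid_point_in_cell:
  assumes "valid_mesh M"
  shows "grid_point M l \<in> cell M l" "grid_point M (Suc l) \<in> cell M l"
  using mesh_size_pos[OF assms] by (auto simp: cell_def grid_point_Suc)

lemma cell_subset_domain:
  assumes "valid_mesh M" "l < mesh_cells M"
  shows "cell M l \<subseteq> {mesh_origin M..mesh_origin M + mesh_length M}"
proof -
  have "real (Suc l) * mesh_size M \<le> real (mesh_cells M) * mesh_size M"
    using assms by (intro mult_right_mono) (auto simp: less_imp_le[OF mesh_size_pos])
  also have "\<dots> = mesh_length M"
    using assms by (simp add: mesh_size_def)
  finally show ?thesis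
    using mesh_size_pos[OF assms(1)] by (auto simp: cell_def grid_point_def intro: order.trans[rotated])
qed

lemma cell_point_first: "K \<ge> 1 \<Longrightarrow> cell_point M K l 0 = grid_point M l"
  by (simp add: cell_point_def gl_point_first)

lemma cell_point_last: "K \<ge> 1 \<Longrightarrow> cell_point M K l K = grid_point M (Suc l)"
  by (simp add: cell_point_def gl_point_last grid_point_Suc)

lemma cell_point_in_cell:
  assumes "valid_mesh M" "K \<ge> 1" "k \<le> K"
  shows "cell_point M K l k \<in> cell M l"
proof -
  have "0 \<le> mesh_size M * (1 + gl_point K k)" "mesh_size M * (1 + gl_point K k) \<le> mesh_size M * 2"
    using gl_point_bounds[OF assms(2,3)] mesh_size_pos[OF assms(1)]
    by (auto intro!: mult_left_mono)
  then show ?thesis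
    by (auto simp: cell_def cell_point_def grid_point_Suc)
qed

lemma inj_on_cell_point:
  assumes "valid_mesh M" "K \<ge> 1"
  shows "inj_on (cell_point M K l) {..K}"
  using inj_on_gl_point[OF assms(2)] mesh_size_pos[OF assms(1)]
  by (auto simp: inj_on_def cell_point_def)

lemma finite_nodes1d: "finite (nodes1d M K)"
proof -
  have "nodes1d M K = (\<lambda>(l, k). cell_point M K l k) ` ({..<mesh_cells M} \<times> {..K})"
    by (force simp: nodes1d_def)
  then show ?thesis by simp
qed

lemma cell_point_in_nodes1d: "l < mesh_cells M \<Longrightarrow> k \<le> K \<Longrightarrow> cell_point M K l k \<in> nodes1d M K"
  by (auto simp: nodes1d_def)

lemma cell_points_nodes:
  assumes "valid_mesh (fst M)" "valid_mesh (snd M)" "K \<ge> 1" "e \<in> elements M" "k \<le> K" "l \<le> K"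
  shows "(cell_point (fst M) K (fst e) k, cell_point (snd M) K (snd e) l) \<in> nodes M K \<inter> element M e"
  using assms by (auto simp: nodes_def elements_def element_def cell_point_in_cell cell_point_in_nodes1d)

text \<open>One-dimensional fundamental theorem of calculus for a monomial, transported to the
  reference interval, where the quadrature is exact. For \<open>p = 0\<close> the truncated exponent
  \<open>p - 1\<close> is harmless, since the factor \<open>real p\<close> vanishes.\<close>

lemma cell_quadrature_derivative:
  assumes "K \<ge> 1" "p \<le> K"
  shows "(\<Sum>k\<le>K. mesh_size M / 2 * gl_weight K k * (real p * cell_point M K l k ^ (p - 1))) =
    grid_point M (Suc l) ^ p - grid_point M l ^ p"
proof -
  \<comment> \<open>\<open>q\<close> is \<open>x ^ p\<close> composed with the affine map from the
    reference interval to the cell. By the chain rule its derivative already carries the factor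
    \<open>mesh_size M / 2\<close> of the scaled weights.\<close>
  define q where "q = [:grid_point M l + mesh_size M / 2, mesh_size M / 2:] ^ p"
  have poly_q: "poly q x = (grid_point M l + mesh_size M * (1 + x) / 2) ^ p" for x
    by (simp add: q_def poly_power algebra_simps add_divide_distrib)
  have deriv: "poly (pderiv q) x =
      mesh_size M / 2 * (real p * (grid_point M l + mesh_size M * (1 + x) / 2) ^ (p - 1))" for x
    by (simp add: q_def pderiv_power pderiv_pCons poly_power algebra_simps add_divide_distrib)
  have "degree q \<le> p * 1"
    unfolding q_def by (rule order.trans[OF degree_power_le]) auto
  then have "degree (pderiv q) \<le> K"
    using assms(2) by (simp add: degree_pderiv)
  from gl_weight_exact[OF assms(1) this]
  have "(\<Sum>k\<le>K. gl_weight K k * poly (pderiv q) (gl_point K k)) = integral {-1..1} (poly (pderiv q))" .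
  also have "(poly (pderiv q) has_integral (poly q 1 - poly q (-1))) {-1..1}"
    by (intro fundamental_theorem_of_calculus)
       (auto intro!: has_field_derivative_at_within poly_DERIV
             simp flip: has_real_derivative_iff_has_vector_derivative)
  then have "integral {-1..1} (poly (pderiv q)) = poly q 1 - poly q (-1)"
    by (rule integral_unique)
  finally show ?thesis
    by (simp add: deriv poly_q cell_point_def grid_point_Suc mult_ac)
qed

text \<open>The derivative is taken within the cell, so a representation valid on the element alone
  determines it, and positive mesh size makes it unique. The factors \<open>f i\<close> and
  \<open>g i\<close> are kept abstract so that the resulting formula can serve as the representation
  for a second derivative.\<close>

lemma has_vector_derivative_elem_dx1:
  fixes u :: "real \<times> real \<Rightarrow> 'a::euclidean_space"
  assumes "valid_mesh (fst M)" "(a, b) \<in> element M e"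
    and u: "\<And>x y. (x, y) \<in> element M e \<Longrightarrow> u (x, y) = (\<Sum>i\<in>I. (f i x * g i y) *\<^sub>R C i)"
    and f: "\<And>i x. (f i has_real_derivative f' i x) (at x)"
  shows "((\<lambda>\<xi>. u (\<xi>, b)) has_vector_derivative elem_dx1 M e u (a, b)) (at a within cell (fst M) (fst e))"
    and "elem_dx1 M e u (a, b) = (\<Sum>i\<in>I. (f' i a * g i b) *\<^sub>R C i)"
proof -
  let ?D = "\<Sum>i\<in>I. (f' i a * g i b) *\<^sub>R C i"
  have "((\<lambda>\<xi>. \<Sum>i\<in>I. (f i \<xi> * g i b) *\<^sub>R C i) has_vector_derivative ?D)
      (at a within cell (fst M) (fst e))"
    by (rule derivative_eq_intros DERIV_subset[OF f] | simp)+
  then have *: "((\<lambda>\<xi>. u (\<xi>, b)) has_vector_derivative ?D) (at a within cell (fst M) (fst e))"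
    by (rule has_vector_derivative_transform[rotated 2])
       (use assms(2) u in \<open>auto simp: element_def\<close>)
  then show **: "elem_dx1 M e u (a, b) = ?D"
    unfolding elem_dx1_def cell_def prod.case
    using assms(2) mesh_size_pos[OF assms(1)]
    by (intro vector_derivative_within_closed_interval)
       (auto simp: grid_point_Suc element_def cell_def)
  show "((\<lambda>\<xi>. u (\<xi>, b)) has_vector_derivative elem_dx1 M e u (a, b)) (at a within cell (fst M) (fst e))"
    using * unfolding ** .
qed

lemma has_vector_derivative_elem_dx2:
  fixes u :: "real \<times> real \<Rightarrow> 'a::euclidean_space"
  assumes "valid_mesh (snd M)" "(a, b) \<in> element M e"
    and u: "\<And>x y. (x, y) \<in> element M e \<Longrightarrow> u (x, y) = (\<Sum>i\<in>I. (f i x * g i y) *\<^sub>R C i)"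
    and g: "\<And>i y. (g i has_real_derivative g' i y) (at y)"
  shows "((\<lambda>\<eta>. u (a, \<eta>)) has_vector_derivative elem_dx2 M e u (a, b)) (at b within cell (snd M) (snd e))"
    and "elem_dx2 M e u (a, b) = (\<Sum>i\<in>I. (f i a * g' i b) *\<^sub>R C i)"
proof -
  let ?D = "\<Sum>i\<in>I. (f i a * g' i b) *\<^sub>R C i"
  have "((\<lambda>\<eta>. \<Sum>i\<in>I. (f i a * g i \<eta>) *\<^sub>R C i) has_vector_derivative ?D)
      (at b within cell (snd M) (snd e))"
    by (rule derivative_eq_intros DERIV_subset[OF g] | simp add: mult.commute)+
  then have *: "((\<lambda>\<eta>. u (a, \<eta>)) has_vector_derivative ?D) (at b within cell (snd M) (snd e))"
    by (rule has_vector_derivative_transform[rotated 2])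
       (use assms(2) u in \<open>auto simp: element_def\<close>)
  then show **: "elem_dx2 M e u (a, b) = ?D"
    unfolding elem_dx2_def cell_def prod.case
    using assms(2) mesh_size_pos[OF assms(1)]
    by (intro vector_derivative_within_closed_interval)
       (auto simp: grid_point_Suc element_def cell_def)
  show "((\<lambda>\<eta>. u (a, \<eta>)) has_vector_derivative elem_dx2 M e u (a, b)) (at b within cell (snd M) (snd e))"
    using * unfolding ** .
qed

text \<open>Brings the double sum into the separated form that the derivative lemmas expect. Writing
  \<open>*\<^sub>R\<close> lets scalar and vector-valued functions share that form.\<close>

lemma fe_space_tensor:
  assumes "u \<in> fe_space M K" "e \<in> elements M"
  obtains c where "\<And>x y. (x, y) \<in> element M e \<Longrightarrow>
    u (x, y) = (\<Sum>i\<in>{..K} \<times> {..K}. (x ^ fst i * y ^ snd i) *\<^sub>R c i)"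
proof -
  obtain c where c: "\<forall>(x, y)\<in>element M e. u (x, y) = (\<Sum>p\<le>K. \<Sum>q\<le>K. c p q * x ^ p * y ^ q)"
    using assms unfolding fe_space_def by blast
  show thesis
    by (rule that[of "\<lambda>(p, q). c p q"])
       (use c in \<open>auto simp: sum.cartesian_product case_prod_beta mult_ac\<close>)
qed

text \<open>The space is defined componentwise, so coefficients are chosen for each component and
  then collected into vectors.\<close>

lemma fe_space_vec_tensor:
  fixes u :: "real \<times> real \<Rightarrow> real ^ 's"
  assumes "u \<in> fe_space_vec M K" "e \<in> elements M"
  obtains C where "\<And>x y. (x, y) \<in> element M e \<Longrightarrow>
    u (x, y) = (\<Sum>i\<in>{..K} \<times> {..K}. (x ^ fst i * y ^ snd i) *\<^sub>R C i)"
proof -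
  have "\<forall>s. \<exists>c. \<forall>x y. (x, y) \<in> element M e \<longrightarrow>
      u (x, y) $ s = (\<Sum>i\<in>{..K} \<times> {..K}. (x ^ fst i * y ^ snd i) *\<^sub>R c i)"
  proof
    fix s
    have "(\<lambda>z. u z $ s) \<in> fe_space M K"
      using assms(1) by (simp add: fe_space_vec_def)
    from fe_space_tensor[OF this assms(2)] show "\<exists>c. \<forall>x y. (x, y) \<in> element M e \<longrightarrow>
      u (x, y) $ s = (\<Sum>i\<in>{..K} \<times> {..K}. (x ^ fst i * y ^ snd i) *\<^sub>R c i)"
      by metis
  qed
  then obtain c where c: "\<And>s x y. (x, y) \<in> element M e \<Longrightarrow>
      u (x, y) $ s = (\<Sum>i\<in>{..K} \<times> {..K}. (x ^ fst i * y ^ snd i) *\<^sub>R c s i)"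
    by metis
  show thesis
    by (rule that[of "\<lambda>i. \<chi> s. c s i"]) (simp add: vec_eq_iff c sum_component)
qed

lemma power_has_real_derivative:
  "((\<lambda>x. x ^ n) has_real_derivative real n * x ^ (n - 1)) (at x)"
  by (rule derivative_eq_intros | simp)+

section \<open>Tensor-product quadrature and mixed derivatives\<close>

lemma gl_quadrature_cong:
  assumes "valid_mesh (fst M)" "valid_mesh (snd M)" "K \<ge> 1"
    and "\<And>z. z \<in> element M e \<Longrightarrow> f z = g z"
  shows "gl_quadrature M K e f = gl_quadrature M K e g"
  unfolding gl_quadrature_def
  by (intro sum.cong refl arg_cong[where f = "scaleR _"] assms(4))
     (auto simp: element_def intro!: cell_point_in_cell assms)

lemma gl_quadrature_add:
  "gl_quadrature M K e (\<lambda>z. f z + g z) = gl_quadrature M K e f + gl_quadrature M K e g"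
  by (simp add: gl_quadrature_def scaleR_add_right sum.distrib)

lemma gl_quadrature_sum:
  "gl_quadrature M K e (\<lambda>z. \<Sum>\<alpha>\<in>A. f \<alpha> z) = (\<Sum>\<alpha>\<in>A. gl_quadrature M K e (f \<alpha>))"
  by (induction A rule: infinite_finite_induct) (simp_all add: gl_quadrature_add, simp_all add: gl_quadrature_def)

text \<open>On a separated term the tensor rule factors into two one-dimensional rules, to which
  \<open>cell_quadrature_derivative\<close> applies.\<close>

lemma gl_quadrature_scaleR_const:
  "gl_quadrature M K e (\<lambda>z. (f (fst z) * g (snd z)) *\<^sub>R C) =
    ((\<Sum>k\<le>K. mesh_size (fst M) / 2 * gl_weight K k * f (cell_point (fst M) K (fst e) k)) *
     (\<Sum>l\<le>K. mesh_size (snd M) / 2 * gl_weight K l * g (cell_point (snd M) K (snd e) l))) *\<^sub>R C"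
  by (simp add: gl_quadrature_def sum_product scaleR_sum_left mult_ac)

text \<open>Both orders of differentiation yield the same monomial sum \<open>?G\<close> on the
  element. Each of its terms integrates to a product of two differences of powers, whose four
  products are the corner values of that monomial.\<close>

lemma gl_quadrature_mixed_derivative:
  fixes u :: "real \<times> real \<Rightarrow> real ^ 's"
  assumes mesh: "valid_mesh (fst M)" "valid_mesh (snd M)" "K \<ge> 1"
    and u: "u \<in> fe_space_vec M K" and e: "e \<in> elements M"
  defines "a \<equiv> grid_point (fst M) (fst e)" and "b \<equiv> grid_point (fst M) (Suc (fst e))"
    and "c \<equiv> grid_point (snd M) (snd e)" and "d \<equiv> grid_point (snd M) (Suc (snd e))"
  shows "gl_quadrature M K e (elem_dx1 M e (elem_dx2 M e u)) =
      u (b, d) - u (a, d) - u (b, c) + u (a, c)"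
    and "gl_quadrature M K e (elem_dx2 M e (elem_dx1 M e u)) =
      u (b, d) - u (a, d) - u (b, c) + u (a, c)"
proof -
  let ?I = "{..K} \<times> {..K}"
  obtain C where C: "\<And>x y. (x, y) \<in> element M e \<Longrightarrow>
      u (x, y) = (\<Sum>i\<in>?I. (x ^ fst i * y ^ snd i) *\<^sub>R C i)"
    using fe_space_vec_tensor[OF u e] by blast
  let ?G = "\<lambda>z. \<Sum>i\<in>?I. ((real (fst i) * fst z ^ (fst i - 1)) * (real (snd i) * snd z ^ (snd i - 1))) *\<^sub>R C i"
  have dx12: "elem_dx1 M e (elem_dx2 M e u) z = ?G z" if "z \<in> element M e" for z
    using has_vector_derivative_elem_dx1(2)[OF mesh(1) _
        has_vector_derivative_elem_dx2(2)[OF mesh(2) _ C power_has_real_derivative]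
        power_has_real_derivative, of "fst z" "snd z"] that by simp
  have dx21: "elem_dx2 M e (elem_dx1 M e u) z = ?G z" if "z \<in> element M e" for z
    using has_vector_derivative_elem_dx2(2)[OF mesh(2) _
        has_vector_derivative_elem_dx1(2)[OF mesh(1) _ C power_has_real_derivative]
        power_has_real_derivative, of "fst z" "snd z"] that by simp
  have quad: "gl_quadrature M K e ?G = u (b, d) - u (a, d) - u (b, c) + u (a, c)"
  proof -
    have "gl_quadrature M K e ?G = (\<Sum>i\<in>?I. ((b ^ fst i - a ^ fst i) * (d ^ snd i - c ^ snd i)) *\<^sub>R C i)"
      unfolding gl_quadrature_sum
    proof (rule sum.cong[OF refl])
      fix i assume "i \<in> ?I"
      then show "gl_quadrature M K e (\<lambda>z. ((real (fst i) * fst z ^ (fst i - 1)) * (real (snd i) * snd z ^ (snd i - 1))) *\<^sub>R C i) =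
          ((b ^ fst i - a ^ fst i) * (d ^ snd i - c ^ snd i)) *\<^sub>R C i"
        using mesh(3)
        by (subst gl_quadrature_scaleR_const, subst (1 2) cell_quadrature_derivative)
           (auto simp: a_def b_def c_def d_def)
    qed
    also have "\<dots> = u (b, d) - u (a, d) - u (b, c) + u (a, c)"
    proof -
      have "(x, y) \<in> element M e" if "x \<in> {a, b}" "y \<in> {c, d}" for x y
        using that grid_point_in_cell[OF mesh(1)] grid_point_in_cell[OF mesh(2)]
        unfolding element_def a_def b_def c_def d_def by auto
      then have "u (x, y) = (\<Sum>i\<in>?I. (x ^ fst i * y ^ snd i) *\<^sub>R C i)" if "x \<in> {a, b}" "y \<in> {c, d}" for x y
        using that by (intro C) auto
      then have corners: "u (b, d) = (\<Sum>i\<in>?I. (b ^ fst i * d ^ snd i) *\<^sub>R C i)"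
        "u (a, d) = (\<Sum>i\<in>?I. (a ^ fst i * d ^ snd i) *\<^sub>R C i)"
        "u (b, c) = (\<Sum>i\<in>?I. (b ^ fst i * c ^ snd i) *\<^sub>R C i)"
        "u (a, c) = (\<Sum>i\<in>?I. (a ^ fst i * c ^ snd i) *\<^sub>R C i)"
        by blast+
      show ?thesis
        unfolding corners sum.distrib[symmetric] sum_subtractf[symmetric]
        by (intro sum.cong refl) (simp add: left_diff_distrib right_diff_distrib scaleR_diff_left)
    qed
    finally show ?thesis .
  qed
  show "gl_quadrature M K e (elem_dx1 M e (elem_dx2 M e u)) =
      u (b, d) - u (a, d) - u (b, c) + u (a, c)"
    by (rule trans[OF gl_quadrature_cong[OF mesh dx12] quad])
  show "gl_quadrature M K e (elem_dx2 M e (elem_dx1 M e u)) =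
      u (b, d) - u (a, d) - u (b, c) + u (a, c)"
    by (rule trans[OF gl_quadrature_cong[OF mesh dx21] quad])
qed

section \<open>Unisolvence on tensor grids and the partition of unity\<close>

lemma poly_unisolvent:
  fixes c :: "nat \<Rightarrow> real"
  assumes "\<And>x. x \<in> X \<Longrightarrow> (\<Sum>p\<le>K. c p * x ^ p) = r" "card X > K"
  shows "(\<Sum>p\<le>K. c p * x ^ p) = r"
proof -
  define q where "q = (\<Sum>p\<le>K. monom (c p) p)"
  have poly_q: "poly q x = (\<Sum>p\<le>K. c p * x ^ p)" for x
    by (simp add: q_def poly_sum poly_monom)
  have "degree q \<le> K"
    unfolding q_def by (intro degree_sum_le) (auto intro: order.trans[OF degree_monom_le])
  then have "q = [:r:]"
    using assms by (intro poly_eqI_degree[of X]) (auto simp: poly_q)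
  then show ?thesis
    using poly_q[of x] by simp
qed

text \<open>Applies the one-variable result twice: \<open>rows\<close> regroups the sum as a
  polynomial in \<open>x\<close>, \<open>cols\<close> as a polynomial in \<open>y\<close>.\<close>

lemma tensor_unisolvent:
  fixes c :: "nat \<times> nat \<Rightarrow> real"
  assumes eq: "\<And>x y. x \<in> X \<Longrightarrow> y \<in> Y \<Longrightarrow> (\<Sum>i\<in>{..K} \<times> {..K}. (x ^ fst i * y ^ snd i) * c i) = r"
    and "card X > K" "card Y > K"
  shows "(\<Sum>i\<in>{..K} \<times> {..K}. (x ^ fst i * y ^ snd i) * c i) = r"
proof -
  have rows: "(\<Sum>i\<in>{..K} \<times> {..K}. (x ^ fst i * y ^ snd i) * c i) = (\<Sum>p\<le>K. (\<Sum>q\<le>K. c (p, q) * y ^ q) * x ^ p)"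
    and cols: "(\<Sum>i\<in>{..K} \<times> {..K}. (x ^ fst i * y ^ snd i) * c i) = (\<Sum>q\<le>K. (\<Sum>p\<le>K. c (p, q) * x ^ p) * y ^ q)"
    for x y
  proof -
    show rows: "(\<Sum>i\<in>{..K} \<times> {..K}. (x ^ fst i * y ^ snd i) * c i) = (\<Sum>p\<le>K. (\<Sum>q\<le>K. c (p, q) * y ^ q) * x ^ p)"
      by (simp add: sum.cartesian_product' sum_distrib_right sum_distrib_left mult_ac)
    show "(\<Sum>i\<in>{..K} \<times> {..K}. (x ^ fst i * y ^ snd i) * c i) = (\<Sum>q\<le>K. (\<Sum>p\<le>K. c (p, q) * x ^ p) * y ^ q)"
      unfolding rows sum_distrib_right by (subst sum.swap) (simp add: mult_ac)
  qed
  \<comment> \<open>Frees \<open>x\<close> while \<open>y\<close> stays on the grid; afterwards the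
    identity holds for each fixed \<open>x\<close> at all grid values of \<open>y\<close>, which
    frees \<open>y\<close>.\<close>
  have "(\<Sum>p\<le>K. (\<Sum>q\<le>K. c (p, q) * y ^ q) * x ^ p) = r" if "y \<in> Y" for x y
    by (rule poly_unisolvent[OF _ assms(2)]) (use eq[OF _ that] in \<open>unfold rows\<close>)
  then have "(\<Sum>i\<in>{..K} \<times> {..K}. (x ^ fst i * y ^ snd i) * c i) = r" if "y \<in> Y" for x y
    unfolding rows using that .
  then have "(\<Sum>q\<le>K. (\<Sum>p\<le>K. c (p, q) * x ^ p) * y ^ q) = r" for y
    unfolding cols by (rule poly_unisolvent[OF _ assms(3)])
  then show ?thesis
    unfolding cols .
qed

lemma finite_nodes: "finite (nodes M K)"
  by (simp add: nodes_def finite_nodes1d)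

lemma nodal_basis_partition_of_unity:
  assumes mesh: "valid_mesh (fst M)" "valid_mesh (snd M)" "K \<ge> 1"
    and basis: "nodal_basis M K \<phi>" and e: "e \<in> elements M" and z: "z \<in> element M e"
  shows "(\<Sum>\<alpha>\<in>nodes M K \<inter> element M e. \<phi> \<alpha> z) = 1"
proof -
  let ?A = "nodes M K \<inter> element M e"
  have "\<forall>\<alpha>\<in>?A. \<exists>c. \<forall>x y. (x, y) \<in> element M e \<longrightarrow>
      \<phi> \<alpha> (x, y) = (\<Sum>i\<in>{..K} \<times> {..K}. (x ^ fst i * y ^ snd i) *\<^sub>R c i)"
  proof
    fix \<alpha> assume "\<alpha> \<in> ?A"
    then have "\<phi> \<alpha> \<in> fe_space M K"
      using basis by (simp add: nodal_basis_def)
    from fe_space_tensor[OF this e] show "\<exists>c. \<forall>x y. (x, y) \<in> element M e \<longrightarrow>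
      \<phi> \<alpha> (x, y) = (\<Sum>i\<in>{..K} \<times> {..K}. (x ^ fst i * y ^ snd i) *\<^sub>R c i)"
      by metis
  qed
  from bchoice[OF this] obtain c where "\<forall>\<alpha>\<in>?A. \<forall>x y. (x, y) \<in> element M e \<longrightarrow>
      \<phi> \<alpha> (x, y) = (\<Sum>i\<in>{..K} \<times> {..K}. (x ^ fst i * y ^ snd i) *\<^sub>R c \<alpha> i)" ..
  then have c: "\<phi> \<alpha> (x, y) = (\<Sum>i\<in>{..K} \<times> {..K}. (x ^ fst i * y ^ snd i) *\<^sub>R c \<alpha> i)"
    if "\<alpha> \<in> ?A" "(x, y) \<in> element M e" for \<alpha> x y
    using that by blast
  \<comment> \<open>Adding the coefficients turns the sum of basis functions into a single tensor
    polynomial, to which unisolvence applies.\<close>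
  define C where "C i = (\<Sum>\<alpha>\<in>?A. c \<alpha> i)" for i
  have C: "(\<Sum>\<alpha>\<in>?A. \<phi> \<alpha> (x, y)) = (\<Sum>i\<in>{..K} \<times> {..K}. (x ^ fst i * y ^ snd i) * C i)"
    if "(x, y) \<in> element M e" for x y
    unfolding C_def sum_distrib_left by (subst sum.swap) (use c[OF _ that] in simp)
  define X where "X = cell_point (fst M) K (fst e) ` {..K}"
  define Y where "Y = cell_point (snd M) K (snd e) ` {..K}"
  have cards: "card X > K" "card Y > K"
    unfolding X_def Y_def card_image[OF inj_on_cell_point[OF mesh(1,3)]]
      card_image[OF inj_on_cell_point[OF mesh(2,3)]] by simp_all
  have at_nodes: "(\<Sum>i\<in>{..K} \<times> {..K}. (x ^ fst i * y ^ snd i) * C i) = 1" if "x \<in> X" "y \<in> Y" for x y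
  proof -
    have xy: "(x, y) \<in> ?A"
      using that cell_points_nodes[OF mesh e] unfolding X_def Y_def by blast
    \<comment> \<open>The Kronecker property collapses the sum as soon as \<open>(x, y)\<close> is
      itself in \<open>?A\<close>; the nodes in the element never have to be enumerated.\<close>
    have "(\<Sum>\<alpha>\<in>?A. \<phi> \<alpha> (x, y)) = (\<Sum>\<alpha>\<in>?A. if \<alpha> = (x, y) then 1 else 0)"
      using basis xy by (intro sum.cong refl) (auto simp: nodal_basis_def)
    also have "\<dots> = 1"
      using xy finite_nodes by simp
    finally show ?thesis
      using C xy by auto
  qed
  have "(\<Sum>i\<in>{..K} \<times> {..K}. (fst z ^ fst i * snd z ^ snd i) * C i) = 1"
    by (rule tensor_unisolvent[OF at_nodes cards])
  then show ?thesis
    using C[of "fst z" "snd z"] z by simp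
qed

lemma sum_elem_dx_nodal_basis:
  assumes mesh: "valid_mesh (fst M)" "valid_mesh (snd M)" "K \<ge> 1"
    and basis: "nodal_basis M K \<phi>" and e: "e \<in> elements M" and z: "z \<in> element M e"
  shows "(\<Sum>\<alpha>\<in>nodes M K \<inter> element M e. elem_dx1 M e (\<phi> \<alpha>) z) = 0"
    and "(\<Sum>\<alpha>\<in>nodes M K \<inter> element M e. elem_dx2 M e (\<phi> \<alpha>) z) = 0"
proof -
  let ?A = "nodes M K \<inter> element M e"
  obtain a b where ab: "z = (a, b)" by (cases z)
  have deriv: "((\<lambda>\<xi>. \<phi> \<alpha> (\<xi>, b)) has_vector_derivative elem_dx1 M e (\<phi> \<alpha>) (a, b)) (at a within cell (fst M) (fst e))"
    "((\<lambda>\<eta>. \<phi> \<alpha> (a, \<eta>)) has_vector_derivative elem_dx2 M e (\<phi> \<alpha>) (a, b)) (at b within cell (snd M) (snd e))"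
    if "\<alpha> \<in> ?A" for \<alpha>
  proof -
    have "\<phi> \<alpha> \<in> fe_space M K"
      using basis that by (simp add: nodal_basis_def)
    then obtain c where c: "\<And>x y. (x, y) \<in> element M e \<Longrightarrow>
        \<phi> \<alpha> (x, y) = (\<Sum>i\<in>{..K} \<times> {..K}. (x ^ fst i * y ^ snd i) *\<^sub>R c i)"
      using fe_space_tensor[OF _ e] by blast
    show "((\<lambda>\<xi>. \<phi> \<alpha> (\<xi>, b)) has_vector_derivative elem_dx1 M e (\<phi> \<alpha>) (a, b)) (at a within cell (fst M) (fst e))"
      using z ab by (intro has_vector_derivative_elem_dx1(1)[OF mesh(1) _ c power_has_real_derivative]) auto
    show "((\<lambda>\<eta>. \<phi> \<alpha> (a, \<eta>)) has_vector_derivative elem_dx2 M e (\<phi> \<alpha>) (a, b)) (at b within cell (snd M) (snd e))"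
      using z ab by (intro has_vector_derivative_elem_dx2(1)[OF mesh(2) _ c power_has_real_derivative]) auto
  qed
  have unity: "(\<Sum>\<alpha>\<in>?A. \<phi> \<alpha> (x, y)) = 1" if "(x, y) \<in> element M e" for x y
    by (rule nodal_basis_partition_of_unity[OF mesh basis e that])
  have "((\<lambda>\<xi>. \<Sum>\<alpha>\<in>?A. \<phi> \<alpha> (\<xi>, b)) has_vector_derivative (\<Sum>\<alpha>\<in>?A. elem_dx1 M e (\<phi> \<alpha>) (a, b))) (at a within cell (fst M) (fst e))"
    by (intro has_vector_derivative_sum deriv)
  \<comment> \<open>The sum over the nodes of this element is known to be 1 only on the element,
    which is enough for a derivative within the cell.\<close>
  then have "((\<lambda>\<xi>. 1) has_vector_derivative (\<Sum>\<alpha>\<in>?A. elem_dx1 M e (\<phi> \<alpha>) (a, b))) (at a within cell (fst M) (fst e))"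
    by (rule has_vector_derivative_transform[rotated 2])
       (use z ab unity in \<open>auto simp: element_def\<close>)
  moreover have "((\<lambda>\<xi>. 1) has_vector_derivative (0::real)) (at a within cell (fst M) (fst e))"
    by simp
  \<comment> \<open>Derivatives within a set are unique at its limit points. As the cell has
    positive length, this covers its end points as well.\<close>
  ultimately show "(\<Sum>\<alpha>\<in>?A. elem_dx1 M e (\<phi> \<alpha>) z) = 0"
    unfolding ab using z ab mesh_size_pos[OF mesh(1)]
    by (intro vector_derivative_unique_within[of a "cell (fst M) (fst e)"])
       (auto simp: element_def cell_def grid_point_Suc trivial_limit_within islimpt_Icc)
  have "((\<lambda>\<eta>. \<Sum>\<alpha>\<in>?A. \<phi> \<alpha> (a, \<eta>)) has_vector_derivative (\<Sum>\<alpha>\<in>?A. elem_dx2 M e (\<phi> \<alpha>) (a, b))) (at b within cell (snd M) (snd e))"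
    by (intro has_vector_derivative_sum deriv)
  then have "((\<lambda>\<eta>. 1) has_vector_derivative (\<Sum>\<alpha>\<in>?A. elem_dx2 M e (\<phi> \<alpha>) (a, b))) (at b within cell (snd M) (snd e))"
    by (rule has_vector_derivative_transform[rotated 2])
       (use z ab unity in \<open>auto simp: element_def\<close>)
  moreover have "((\<lambda>\<eta>. 1) has_vector_derivative (0::real)) (at b within cell (snd M) (snd e))"
    by simp
  ultimately show "(\<Sum>\<alpha>\<in>?A. elem_dx2 M e (\<phi> \<alpha>) z) = 0"
    unfolding ab using z ab mesh_size_pos[OF mesh(2)]
    by (intro vector_derivative_unique_within[of b "cell (snd M) (snd e)"])
       (auto simp: element_def cell_def grid_point_Suc trivial_limit_within islimpt_Icc)
qed

text \<open>The finite sum passes through the quadrature. At each point \<open>supg_matrix\<close>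
  is linear in the two derivatives of the test function, with matrices independent of the node, so
  the vanishing summed gradient annihilates both stabilization terms and the partition of unity
  leaves the divergence.\<close>

lemma sum_fluctuation:
  fixes D :: "real \<times> real \<Rightarrow> real ^ 's"
  assumes mesh: "valid_mesh (fst M)" "valid_mesh (snd M)" "K \<ge> 1"
    and basis: "nodal_basis M K \<phi>" and e: "e \<in> elements M"
  shows "(\<Sum>\<alpha>\<in>nodes M K \<inter> element M e. fluctuation M K e (\<phi> \<alpha>) P1 P2 J1 J2 \<tau> D) =
    gl_quadrature M K e (gf_divergence M e P1 P2)"
proof -
  let ?A = "nodes M K \<inter> element M e"
  have supg: "supg_matrix M e \<psi> J1 J2 \<tau> z *v v =
      elem_dx1 M e \<psi> z *\<^sub>R ((J1 z ** \<tau> z) *v v) + elem_dx2 M e \<psi> z *\<^sub>R ((J2 z ** \<tau> z) *v v)" for \<psi> z v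
    by (simp add: supg_matrix_def matrix_vector_mult_add_rdistrib scaleR_matrix_vector_assoc)
  have supg0: "(\<Sum>\<alpha>\<in>?A. supg_matrix M e (\<phi> \<alpha>) J1 J2 \<tau> z *v v) = 0" if "z \<in> element M e" for z v
    by (simp add: supg sum.distrib sum_elem_dx_nodal_basis[OF mesh basis e that]
        flip: scaleR_sum_left)
  show ?thesis
    unfolding fluctuation_def gl_quadrature_sum[symmetric] sum.distrib
    by (rule gl_quadrature_cong[OF mesh])
       (simp add: supg0 nodal_basis_partition_of_unity[OF mesh basis e] flip: scaleR_sum_left)
qed

section \<open>Edge fluxes\<close>

text \<open>Affine substitution in both directions, because a counterclockwise boundary traverses
  two of its edges against the coordinate axis. The edge length \<open>d - c\<close> is the positive
  factor in either case.\<close>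

lemma integral_linepath_Icc:
  fixes g :: "real \<Rightarrow> 'a::euclidean_space"
  assumes "c < d" "g integrable_on {c..d}"
  shows "integral {0..1} (\<lambda>r. (d - c) *\<^sub>R g ((1 - r) * c + r * d)) = integral {c..d} g"
    and "integral {0..1} (\<lambda>r. (d - c) *\<^sub>R g ((1 - r) * d + r * c)) = integral {c..d} g"
proof -
  have g: "(g has_integral integral {c..d} g) (cbox c d)"
    using assms(2) by (simp add: has_integral_integral)
  \<comment> \<open>The substitution rule states its domain as the image under the inverse affine
    map; for either orientation this is the unit interval. The reciprocal of the absolute slope that
    it produces is removed by the factor \<open>d - c\<close>.\<close>
  have image: "(\<lambda>x. (1 / (d - c)) *\<^sub>R x + - ((1 / (d - c)) *\<^sub>R c)) ` cbox c d = {0..1}"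
    "(\<lambda>x. (1 / (c - d)) *\<^sub>R x + - ((1 / (c - d)) *\<^sub>R d)) ` cbox c d = {0..1}"
    unfolding image_affinity_cbox
    using assms(1) by (simp_all add: divide_le_0_iff flip: diff_divide_distrib)
  show "integral {0..1} (\<lambda>r. (d - c) *\<^sub>R g ((1 - r) * c + r * d)) = integral {c..d} g"
    using has_integral_affinity[OF g, of "d - c" c, unfolded image, THEN has_integral_cmul, of "d - c"] assms(1)
    by (intro integral_unique) (simp add: algebra_simps)
  show "integral {0..1} (\<lambda>r. (d - c) *\<^sub>R g ((1 - r) * d + r * c)) = integral {c..d} g"
    using has_integral_affinity[OF g, of "c - d" d, unfolded image, THEN has_integral_cmul, of "d - c"] assms(1)
    by (intro integral_unique) (simp add: algebra_simps)
qed

text \<open>Arc length is blind to the direction of travel, so both orientations give the same value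
  and the sign enters only through the normal component \<open>s\<close>.\<close>

lemma edge_flux_vertical:
  fixes f1 f2 :: "real \<times> real \<Rightarrow> real ^ 's"
  assumes "c < d" "(\<lambda>\<eta>. f1 (x, \<eta>)) integrable_on {c..d}"
  shows "edge_flux (x, c) (x, d) (s, 0) f1 f2 = s *\<^sub>R integral {c..d} (\<lambda>\<eta>. f1 (x, \<eta>))"
    and "edge_flux (x, d) (x, c) (s, 0) f1 f2 = s *\<^sub>R integral {c..d} (\<lambda>\<eta>. f1 (x, \<eta>))"
proof -
  have path: "linepath (x, p) (x, q) r = (x, (1 - r) * p + r * q)" for p q r
    by (simp add: linepath_def algebra_simps)
  have dist: "dist (x, c) (x, d) = d - c" "dist (x, d) (x, c) = d - c"
    using assms(1) by (simp_all add: dist_Pair_Pair dist_real_def)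
  show "edge_flux (x, c) (x, d) (s, 0) f1 f2 = s *\<^sub>R integral {c..d} (\<lambda>\<eta>. f1 (x, \<eta>))"
    unfolding edge_flux_def path dist integral_linepath_Icc(1)[OF assms, symmetric]
    by (simp flip: integral_cmul add: mult.commute)
  show "edge_flux (x, d) (x, c) (s, 0) f1 f2 = s *\<^sub>R integral {c..d} (\<lambda>\<eta>. f1 (x, \<eta>))"
    unfolding edge_flux_def path dist integral_linepath_Icc(2)[OF assms, symmetric]
    by (simp flip: integral_cmul add: mult.commute)
qed

lemma edge_flux_horizontal:
  fixes f1 f2 :: "real \<times> real \<Rightarrow> real ^ 's"
  assumes "a < b" "(\<lambda>\<xi>. f2 (\<xi>, y)) integrable_on {a..b}"
  shows "edge_flux (a, y) (b, y) (0, s) f1 f2 = s *\<^sub>R integral {a..b} (\<lambda>\<xi>. f2 (\<xi>, y))"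
    and "edge_flux (b, y) (a, y) (0, s) f1 f2 = s *\<^sub>R integral {a..b} (\<lambda>\<xi>. f2 (\<xi>, y))"
proof -
  have path: "linepath (p, y) (q, y) r = ((1 - r) * p + r * q, y)" for p q r
    by (simp add: linepath_def algebra_simps)
  have dist: "dist (a, y) (b, y) = b - a" "dist (b, y) (a, y) = b - a"
    using assms(1) by (simp_all add: dist_Pair_Pair dist_real_def)
  show "edge_flux (a, y) (b, y) (0, s) f1 f2 = s *\<^sub>R integral {a..b} (\<lambda>\<xi>. f2 (\<xi>, y))"
    unfolding edge_flux_def path dist integral_linepath_Icc(1)[OF assms, symmetric]
    by (simp flip: integral_cmul add: mult.commute)
  show "edge_flux (b, y) (a, y) (0, s) f1 f2 = s *\<^sub>R integral {a..b} (\<lambda>\<xi>. f2 (\<xi>, y))"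
    unfolding edge_flux_def path dist integral_linepath_Icc(2)[OF assms, symmetric]
    by (simp flip: integral_cmul add: mult.commute)
qed

text \<open>Continuity on the domain gives integrability along grid lines, needed to split the
  integrals defining the potentials and to reparametrize the edges.\<close>

lemma fe_space_vec_lines_integrable:
  assumes "u \<in> fe_space_vec M K"
  shows "x \<in> {mesh_origin (fst M)..mesh_origin (fst M) + mesh_length (fst M)} \<Longrightarrow>
      {p..q} \<subseteq> {mesh_origin (snd M)..mesh_origin (snd M) + mesh_length (snd M)} \<Longrightarrow>
      (\<lambda>\<eta>. u (x, \<eta>)) integrable_on {p..q}"
    and "y \<in> {mesh_origin (snd M)..mesh_origin (snd M) + mesh_length (snd M)} \<Longrightarrow>
      {p..q} \<subseteq> {mesh_origin (fst M)..mesh_origin (fst M) + mesh_length (fst M)} \<Longrightarrow>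
      (\<lambda>\<xi>. u (\<xi>, y)) integrable_on {p..q}"
proof -
  have "continuous_on (domain M) (\<lambda>z. \<chi> s. u z $ s)"
    by (rule continuous_on_vec_lambda) (use assms in \<open>simp add: fe_space_vec_def fe_space_def\<close>)
  then have cont: "continuous_on (domain M) u" by simp
  show "(\<lambda>\<eta>. u (x, \<eta>)) integrable_on {p..q}"
    if "x \<in> {mesh_origin (fst M)..mesh_origin (fst M) + mesh_length (fst M)}"
      "{p..q} \<subseteq> {mesh_origin (snd M)..mesh_origin (snd M) + mesh_length (snd M)}"
    by (intro integrable_continuous_interval continuous_on_compose2[OF cont] continuous_intros)
       (use that in \<open>auto simp: domain_def\<close>)
  show "(\<lambda>\<xi>. u (\<xi>, y)) integrable_on {p..q}"
    if "y \<in> {mesh_origin (snd M)..mesh_origin (snd M) + mesh_length (snd M)}"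
      "{p..q} \<subseteq> {mesh_origin (fst M)..mesh_origin (fst M) + mesh_length (fst M)}"
    by (intro integrable_continuous_interval continuous_on_compose2[OF cont] continuous_intros)
       (use that in \<open>auto simp: domain_def\<close>)
qed

text \<open>The potentials are integrals from the lower or left side of the whole domain;
  differences between opposite ends of an edge remove the part outside the element.\<close>

lemma gl_quadrature_gf_divergence:
  fixes F1 F2 P1 P2 :: "real \<times> real \<Rightarrow> real ^ 's"
  assumes mesh: "valid_mesh (fst M)" "valid_mesh (snd M)" "K \<ge> 1" and e: "e \<in> elements M"
    and F: "F1 \<in> fe_space_vec M K" "F2 \<in> fe_space_vec M K"
    and P: "flux_potential1 M K F1 P1" "flux_potential2 M K F2 P2"
  shows "gl_quadrature M K e (gf_divergence M e P1 P2) = boundary_flux M e F1 F2"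
proof -
  define a where "a = grid_point (fst M) (fst e)"
  define b where "b = grid_point (fst M) (Suc (fst e))"
  define c where "c = grid_point (snd M) (snd e)"
  define d where "d = grid_point (snd M) (Suc (snd e))"
  note abcd = a_def b_def c_def d_def
  have lt: "a < b" "c < d"
    using mesh_size_pos[OF mesh(1)] mesh_size_pos[OF mesh(2)] by (simp_all add: abcd grid_point_Suc)
  define X where "X = {mesh_origin (fst M)..mesh_origin (fst M) + mesh_length (fst M)}"
  define Y where "Y = {mesh_origin (snd M)..mesh_origin (snd M) + mesh_length (snd M)}"
  have sub: "{a..b} \<subseteq> X" "{c..d} \<subseteq> Y"
    using e cell_subset_domain[OF mesh(1)] cell_subset_domain[OF mesh(2)]
    by (auto simp: elements_def cell_def abcd X_def Y_def)
  have mem: "a \<in> X" "b \<in> X" "c \<in> Y" "d \<in> Y"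
    using sub lt by auto
  have F1: "(\<lambda>\<eta>. F1 (x, \<eta>)) integrable_on {p..q}" if "x \<in> X" "{p..q} \<subseteq> Y" for x p q
    using fe_space_vec_lines_integrable(1)[OF F(1)] that unfolding X_def Y_def .
  have F2: "(\<lambda>\<xi>. F2 (\<xi>, y)) integrable_on {p..q}" if "y \<in> Y" "{p..q} \<subseteq> X" for y p q
    using fe_space_vec_lines_integrable(2)[OF F(2)] that unfolding X_def Y_def .
  have corners: "(x, y) \<in> nodes M K" if "x \<in> {a, b}" "y \<in> {c, d}" for x y
    using that cell_points_nodes[OF mesh e, of 0 0] cell_points_nodes[OF mesh e, of 0 K]
      cell_points_nodes[OF mesh e, of K 0] cell_points_nodes[OF mesh e, of K K]
    by (auto simp: abcd cell_point_first[OF mesh(3)] cell_point_last[OF mesh(3)])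
  have P_space: "P1 \<in> fe_space_vec M K" "P2 \<in> fe_space_vec M K"
    using P by (simp_all add: flux_potential1_def flux_potential2_def nodal_interpolant_def)
  have P1: "P1 (x, d) - P1 (x, c) = integral {c..d} (\<lambda>\<eta>. F1 (x, \<eta>))" if "x \<in> {a, b}" for x
  proof -
    have "P1 (x, y) = integral {mesh_origin (snd M)..y} (\<lambda>\<eta>. F1 (x, \<eta>))" if "y \<in> {c, d}" for y
      using P(1) corners[OF \<open>x \<in> {a, b}\<close> that]
      by (auto simp: flux_potential1_def nodal_interpolant_def)
    moreover have "integral {mesh_origin (snd M)..c} (\<lambda>\<eta>. F1 (x, \<eta>)) + integral {c..d} (\<lambda>\<eta>. F1 (x, \<eta>)) =
        integral {mesh_origin (snd M)..d} (\<lambda>\<eta>. F1 (x, \<eta>))"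
      using that mem lt by (intro Henstock_Kurzweil_Integration.integral_combine F1) (auto simp: Y_def)
    ultimately show ?thesis by (simp add: algebra_simps)
  qed
  have P2: "P2 (b, y) - P2 (a, y) = integral {a..b} (\<lambda>\<xi>. F2 (\<xi>, y))" if "y \<in> {c, d}" for y
  proof -
    have "P2 (x, y) = integral {mesh_origin (fst M)..x} (\<lambda>\<xi>. F2 (\<xi>, y))" if "x \<in> {a, b}" for x
      using P(2) corners[OF that \<open>y \<in> {c, d}\<close>]
      by (auto simp: flux_potential2_def nodal_interpolant_def)
    moreover have "integral {mesh_origin (fst M)..a} (\<lambda>\<xi>. F2 (\<xi>, y)) + integral {a..b} (\<lambda>\<xi>. F2 (\<xi>, y)) =
        integral {mesh_origin (fst M)..b} (\<lambda>\<xi>. F2 (\<xi>, y))"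
      using that mem lt by (intro Henstock_Kurzweil_Integration.integral_combine F2) (auto simp: X_def)
    ultimately show ?thesis by (simp add: algebra_simps)
  qed
  have "gl_quadrature M K e (gf_divergence M e P1 P2) =
      gl_quadrature M K e (\<lambda>z. elem_dx1 M e (elem_dx2 M e P1) z + elem_dx2 M e (elem_dx1 M e P2) z)"
    by (intro gl_quadrature_cong[OF mesh]) (rule gf_divergence_def)
  also have "\<dots> = (P1 (b, d) - P1 (a, d) - P1 (b, c) + P1 (a, c)) + (P2 (b, d) - P2 (a, d) - P2 (b, c) + P2 (a, c))"
    unfolding gl_quadrature_add gl_quadrature_mixed_derivative(1)[OF mesh P_space(1) e]
      gl_quadrature_mixed_derivative(2)[OF mesh P_space(2) e] abcd ..
  \<comment> \<open>The same four corner values are paired along vertical edges for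
    \<open>P1\<close> and along horizontal edges for \<open>P2\<close>. The remaining signs are
    those of the outward normals.\<close>
  also have "\<dots> = ((P1 (b, d) - P1 (b, c)) - (P1 (a, d) - P1 (a, c))) + ((P2 (b, d) - P2 (a, d)) - (P2 (b, c) - P2 (a, c)))"
    by simp
  also have "\<dots> = boundary_flux M e F1 F2"
    using mem sub lt
    by (simp add: boundary_flux_def Let_def P1 P2 edge_flux_vertical edge_flux_horizontal F1 F2 flip: abcd)
  finally show ?thesis .
qed

text \<open>\<open>\<tau>\<close> takes the element as an argument so that it may jump between
  elements. Differentiating in time within \<open>{0..T}\<close> covers the end times by one-sided
  derivatives.\<close>

theorem mainTheorem2:
  fixes M :: mesh2d
    and K :: nat
    and F1 F2 :: "real ^ 's \<Rightarrow> real ^ 's"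
    and \<tau> :: "mesh2d \<Rightarrow> (real \<times> real \<Rightarrow> real ^ 's) \<Rightarrow> nat \<times> nat \<Rightarrow> real \<times> real \<Rightarrow> real ^ 's ^ 's"
    and \<phi> :: "real \<times> real \<Rightarrow> real \<times> real \<Rightarrow> real"
    and W :: "real \<Rightarrow> real \<times> real \<Rightarrow> real ^ 's"
    and F1h F2h P1h P2h :: "real \<times> real \<Rightarrow> real ^ 's"
    and T t :: real
    and e :: "nat \<times> nat"
  assumes mesh: "valid_mesh (fst M)" "valid_mesh (snd M)"
    and degree: "K \<ge> 1"
    and basis: "nodal_basis M K \<phi>"
    and time: "0 < T" "t \<in> {0..T}"
    and solution: "\<And>r. r \<in> {0..T} \<Longrightarrow> W r \<in> fe_space_vec M K"
    and solution_differentiable: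
      "\<And>\<alpha>. \<alpha> \<in> nodes M K \<Longrightarrow> (\<lambda>r. W r \<alpha>) differentiable (at t within {0..T})"
    and flux_differentiable:
      "\<And>\<alpha>. \<alpha> \<in> nodes M K \<Longrightarrow> F1 differentiable (at (W t \<alpha>))"
      "\<And>\<alpha>. \<alpha> \<in> nodes M K \<Longrightarrow> F2 differentiable (at (W t \<alpha>))"
    and flux_interpolants:
      "nodal_interpolant M K (\<lambda>x. F1 (W t x)) F1h"
      "nodal_interpolant M K (\<lambda>x. F2 (W t x)) F2h"
    and potentials:
      "flux_potential1 M K F1h P1h"
      "flux_potential2 M K F2h P2h"
    and element: "e \<in> elements M"
  shows "(\<Sum>\<alpha>\<in>nodes M K \<inter> element M e.
            fluctuation M K e (\<phi> \<alpha>) P1h P2h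
              (\<lambda>x. jacobian F1 (at (W t x))) (\<lambda>x. jacobian F2 (at (W t x)))
              (\<tau> M (W t) e)
              (\<lambda>x. vector_derivative (\<lambda>r. W r x) (at t within {0..T})))
         = boundary_flux M e F1h F2h"
proof -
  have F: "F1h \<in> fe_space_vec M K" "F2h \<in> fe_space_vec M K"
    using flux_interpolants by (simp_all add: nodal_interpolant_def)
  show ?thesis
    unfolding sum_fluctuation[OF mesh degree basis element]
    by (rule gl_quadrature_gf_divergence[OF mesh degree element F potentials])
qed

end
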